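(* For any $f\in \mathrm{BC}(\mathbb{R}^N)$ there exists a unique $\mathrm{BC}$-solution of the nonlocal Stefan problem $$\partial_t u=J*v-v,\quad v=(u-1)_+\ \text{ in }\mathbb{R}^N\times(0,\infty),\qquad u(\cdot,0)=f .$$
   Context: Standing assumptions: $J:\mathbb{R}^N\to\mathbb{R}$ is continuous, compactly supported, radially symmetric, and $\int_{\mathbb{R}^N}J=1$. Here $*$ is convolution in the space variable and $s_+=\max\{s,0\}$. $\mathrm{BC}(\Omega)$ denotes the set of bounded continuous real functions on $\Omega$. Definition ($\mathrm{BC}$-solution). For $f\in\mathrm{BC}(\mathbb{R}^N)$, a function $u$ is a $\mathrm{BC}$-solution if $u\in\mathrm{BC}(\mathbb{R}^N\times[0,T])$ for all $T\in(0,\infty)$ and $$u(x,t)=f(x)+\int_0^t\big(J*v(x,s)-v(x,s)\big)\,ds,\qquad v=(u-1)_+,$$ for all $x\in\mathbb{R}^N$ and $t\in[0,\infty)$. *)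

theory Defs
  imports "HOL-Analysis.Analysis"
begin

definition BC :: "'a::topological_space set \<Rightarrow> ('a \<Rightarrow> real) set" where
  "BC S = {g. continuous_on S g \<and> bounded (g ` S)}"

definition radially_symmetric :: "('a::real_normed_vector \<Rightarrow> real) \<Rightarrow> bool" where
  "radially_symmetric J \<longleftrightarrow> (\<exists>j. \<forall>x. J x = j (norm x))"

definition compactly_supported :: "('a::topological_space \<Rightarrow> real) \<Rightarrow> bool" where
  "compactly_supported J \<longleftrightarrow> compact (closure {x. J x \<noteq> 0})"

definition convolution ::
    "('a::euclidean_space \<Rightarrow> real) \<Rightarrow> ('a \<Rightarrow> real) \<Rightarrow> 'a \<Rightarrow> real" where
  "convolution J w x = (LINT y|lborel. J (x - y) * w y)"

text \<open>
  A function on \<open>\<real>\<^sup>N \<times> [0,\<infinity>)\<close> is represented by a total function on pairs \<open>(x, t)\<close>, whose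
  values at negative times are irrelevant. The integrals are total Lebesgue integrals; no
  integrability condition is needed, since both integrands are integrable as soon as \<open>J\<close> is
  continuous with compact support and \<open>u\<close> satisfies the \<open>BC\<close> condition.
\<close>

definition BC_solution ::
    "('a::euclidean_space \<Rightarrow> real) \<Rightarrow> ('a \<Rightarrow> real) \<Rightarrow> ('a \<times> real \<Rightarrow> real) \<Rightarrow> bool" where
  "BC_solution J f u \<longleftrightarrow>
     (\<forall>T>0. u \<in> BC (UNIV \<times> {0..T})) \<and>
     (let v = (\<lambda>(x, t). max (u (x, t) - 1) 0) in
        \<forall>x. \<forall>t\<ge>0. u (x, t) =
          f x + (LINT s:{0..t}|lborel. convolution J (\<lambda>y. v (y, s)) x - v (x, s)))"

end

theory Submission
  imports Defs
begin

text \<open>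
  The map \<open>r \<mapsto> (r - 1)\<^sub>+\<close> is 1-Lipschitz, so with \<open>K = \<integral>\<bar>J\<bar>\<close> the right-hand side is
  \<open>(K + 1)\<close>-Lipschitz for the supremum norm in space. Hence the integral equation is a fixed point
  problem for a map that contracts the weighted norm \<open>sup \<bar>u(x,t)\<bar> exp (-\<lambda>t)\<close> by the factor
  \<open>(K + 1)/\<lambda>\<close>. Banach's theorem on the whole half-space gives a global solution, and the same
  estimate on \<open>[0,T]\<close>, where solutions are bounded, gives uniqueness.
\<close>

section \<open>Reflection, rescaling and continuity of Lebesgue integrals\<close>

lemma lborel_integral_reflect:
  fixes g :: "'a::euclidean_space \<Rightarrow> real"
  assumes "g \<in> borel_measurable borel"
  shows "(LINT y|lborel. g y) = (LINT z|lborel. g (x - z))"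
proof -
  have "lborel = density (distr lborel borel (\<lambda>z. x + (-1) *\<^sub>R z)) (\<lambda>_. \<bar>-1::real\<bar> ^ DIM('a))"
    by (rule lborel_affine) simp
  then have "lborel = distr lborel borel (\<lambda>z. x - z)"
    by (simp add: density_1)
  then have "(LINT y|lborel. g y) = (LINT y|distr lborel borel (\<lambda>z. x - z). g y)"
    by simp
  also have "\<dots> = (LINT z|lborel. g (x - z))"
    using assms by (intro integral_distr) auto
  finally show ?thesis .
qed

text \<open>Moves the variable endpoint into the integrand, leaving a fixed interval over which
  continuity in a parameter is available.\<close>

lemma LINT_Icc_rescale:
  fixes g :: "real \<Rightarrow> real"
  assumes "0 \<le> t"
  shows "(LINT s:{0..t}|lborel. g s) = t * (LINT s:{0..1}|lborel. g (t * s))"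
proof (cases "t = 0")
  \<comment> \<open>The substitution needs a nonzero factor, so \<open>t = 0\<close> is separate:
    there the left side is an integral over a single point.\<close>
  case True
  have "(\<lambda>s. indicator {0..0} s *\<^sub>R g s) = (\<lambda>s. indicator {0..0} s *\<^sub>R g 0)"
    by (auto simp: indicator_def)
  then show ?thesis
    using True by (simp add: set_lebesgue_integral_def)
next
  case False
  with assms have "indicator {0..t} (t * s) = (indicator {0..1} s :: real)" for s
    by (auto simp: indicator_def zero_le_mult_iff)
  then show ?thesis
    unfolding set_lebesgue_integral_def
    using False assms lborel_integral_real_affine[of t "\<lambda>s. indicator {0..t} s *\<^sub>R g s" 0] by simp
qed

text \<open>After rescaling, \<open>(x, t)\<close> is only a parameter of an integral over the
  compact interval from 0 to 1, so joint continuity is inherited from the integrand.\<close>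

lemma continuous_on_time_integral:
  fixes F :: "'a::topological_space \<times> real \<Rightarrow> real"
  assumes F: "continuous_on (UNIV \<times> {0..}) F"
  shows "continuous_on (UNIV \<times> {0..}) (\<lambda>(x, t). LINT s:{0..t}|lborel. F (x, s))"
proof -
  have int: "continuous_on (UNIV \<times> {0..}) (\<lambda>p. integral (cbox 0 1) (\<lambda>s. F (fst p, snd p * s)))"
    by (rule integral_continuous_on_param)
       (auto simp: case_prod_unfold intro!: continuous_on_compose2[OF F] continuous_intros)
  have "(LINT s:{0..t}|lborel. F (x, s)) = t * integral (cbox 0 1) (\<lambda>s. F (x, t * s))"
    if "0 \<le> t" for x t
  proof -
    have "set_integrable lborel {0..1} (\<lambda>s. F (x, t * s))"
      using that
      by (intro borel_integrable_atLeastAtMost' continuous_on_compose2[OF F]) (auto intro!: continuous_intros)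
    then show ?thesis
      using that by (simp add: LINT_Icc_rescale set_borel_integral_eq_integral(2))
  qed
  then show ?thesis
    by (auto intro!: continuous_on_eq[OF continuous_on_mult[OF continuous_on_snd[OF continuous_on_id] int]])
qed

section \<open>Fixed point form of the problem\<close>

definition rate :: "('a::euclidean_space \<Rightarrow> real) \<Rightarrow> ('a \<times> real \<Rightarrow> real) \<Rightarrow> 'a \<times> real \<Rightarrow> real" where
  "rate J u = (\<lambda>(x, s). convolution J (\<lambda>y. max (u (y, s) - 1) 0) x - max (u (x, s) - 1) 0)"

definition picard ::
  "('a::euclidean_space \<Rightarrow> real) \<Rightarrow> ('a \<Rightarrow> real) \<Rightarrow> ('a \<times> real \<Rightarrow> real) \<Rightarrow> 'a \<times> real \<Rightarrow> real" where
  "picard J f u = (\<lambda>(x, t). f x + (LINT s:{0..t}|lborel. rate J u (x, s)))"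

lemma BC_solution_iff_picard:
  "BC_solution J f u \<longleftrightarrow>
     (\<forall>T>0. u \<in> BC (UNIV \<times> {0..T})) \<and> (\<forall>x. \<forall>t\<ge>0. u (x, t) = picard J f u (x, t))"
  by (simp add: BC_solution_def Let_def picard_def rate_def)

lemma continuous_on_slice:
  assumes "continuous_on (UNIV \<times> S) u" "s \<in> S"
  shows "continuous_on UNIV (\<lambda>x. u (x, s))"
  using assms by (auto intro!: continuous_on_compose2[OF assms(1)] continuous_intros)

section \<open>Estimates for a continuous kernel supported in a box\<close>

locale compact_kernel =
  fixes J :: "'a::euclidean_space \<Rightarrow> real" and a :: 'a
  assumes cont: "continuous_on UNIV J"
    and supp: "\<And>z. J z \<noteq> 0 \<Longrightarrow> z \<in> cbox (-a) a"
begin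

text \<open>The L1 norm of \<open>J\<close>, which vanishes off the box. As \<open>J\<close> may
  change sign, this can exceed the integral of \<open>J\<close>.\<close>

definition mass :: real where
  "mass = integral (cbox (-a) a) (\<lambda>z. \<bar>J z\<bar>)"

lemma mass_nonneg: "0 \<le> mass"
  unfolding mass_def by (intro integral_nonneg integrable_continuous continuous_intros
      continuous_on_subset[OF cont]) auto

text \<open>Substituting \<open>x - z\<close> for \<open>y\<close> shifts the dependence on
  \<open>x\<close> from the kernel to \<open>w\<close>, so the domain becomes a compact box
  independent of \<open>x\<close>.\<close>

lemma convolution_eq:
  assumes w: "continuous_on UNIV w"
  shows "convolution J w x = integral (cbox (-a) a) (\<lambda>z. J z * w (x - z))"
proof -
  have c: "continuous_on S (\<lambda>z. J z * w (x - z))" for S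
    by (intro continuous_intros continuous_on_compose2[OF w] continuous_on_subset[OF cont]) auto
  have "continuous_on UNIV (\<lambda>y. J (x - y) * w y)"
    by (intro continuous_intros continuous_on_compose2[OF cont] w) auto
  then have "convolution J w x = (LINT z|lborel. J z * w (x - z))"
    unfolding convolution_def
    by (subst lborel_integral_reflect[of _ x]) (auto intro: borel_measurable_continuous_onI)
  also have "\<dots> = (LINT z:cbox (-a) a|lborel. J z * w (x - z))"
    unfolding set_lebesgue_integral_def
    by (intro Bochner_Integration.integral_cong) (use supp in \<open>auto simp: indicator_def\<close>)
  also have "\<dots> = integral (cbox (-a) a) (\<lambda>z. J z * w (x - z))"
    by (intro set_borel_integral_eq_integral) (unfold set_integrable_def, intro borel_integrable_compact compact_cbox c)
  finally show ?thesis .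
qed

lemma rate_eq:
  assumes "continuous_on (UNIV \<times> S) u" "s \<in> S"
  shows "rate J u (x, s) =
    integral (cbox (-a) a) (\<lambda>z. J z * max (u (x - z, s) - 1) 0) - max (u (x, s) - 1) 0"
  unfolding rate_def
  by (simp add: convolution_eq continuous_intros continuous_on_slice[OF assms])

lemma continuous_on_rate:
  assumes u: "continuous_on (UNIV \<times> S) u"
  shows "continuous_on (UNIV \<times> S) (rate J u)"
proof -
  have "continuous_on (UNIV \<times> S)
      (\<lambda>p. integral (cbox (-a) a) (\<lambda>z. J z * max (u (fst p - z, snd p) - 1) 0))"
    unfolding case_prod_unfold
    by (rule integral_continuous_on_param)
       (auto simp: case_prod_unfold intro!: continuous_intros continuous_on_compose2[OF u]
          continuous_on_compose2[OF cont])
  then have "continuous_on (UNIV \<times> S) (\<lambda>p. integral (cbox (-a) a)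
      (\<lambda>z. J z * max (u (fst p - z, snd p) - 1) 0) - max (u p - 1) 0)"
    by (intro continuous_intros u)
  then show ?thesis
    by (rule continuous_on_eq) (auto simp: rate_eq[OF u])
qed

lemma set_integrable_rate:
  assumes "continuous_on (UNIV \<times> {0..T}) u" "t \<le> T"
  shows "set_integrable lborel {0..t} (\<lambda>s. rate J u (x, s))"
  using assms(2)
  by (intro borel_integrable_atLeastAtMost' continuous_on_compose2[OF continuous_on_rate[OF assms(1)]])
     (auto intro!: continuous_intros)

text \<open>The positive part is 1-Lipschitz; the convolution then contributes
  \<open>mass * B\<close> and the local term contributes \<open>B\<close>.\<close>

lemma rate_lipschitz:
  assumes u: "continuous_on (UNIV \<times> S) u" and v: "continuous_on (UNIV \<times> S) v" and s: "s \<in> S"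
    and le: "\<And>x. \<bar>u (x, s) - v (x, s)\<bar> \<le> B"
  shows "\<bar>rate J u (x, s) - rate J v (x, s)\<bar> \<le> (mass + 1) * B"
proof -
  let ?p = "\<lambda>u x. max (u (x, s) - 1) (0::real)"
  have le': "\<bar>?p u x - ?p v x\<bar> \<le> B" for x
    using le[of x] by linarith
  have c: "continuous_on C (\<lambda>z. J z * ?p w (x - z))" if "continuous_on (UNIV \<times> S) w" for w C
    using s by (intro continuous_intros continuous_on_compose2[OF that] continuous_on_subset[OF cont]) auto
  have "\<bar>integral (cbox (-a) a) (\<lambda>z. J z * ?p u (x - z) - J z * ?p v (x - z))\<bar>
      \<le> integral (cbox (-a) a) (\<lambda>z. B * \<bar>J z\<bar>)"
    unfolding real_norm_def[symmetric]
  proof (rule integral_norm_bound_integral)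
    show "norm (J z * ?p u (x - z) - J z * ?p v (x - z)) \<le> B * norm (J z)" for z
      using mult_left_mono[OF le'[of "x - z"], of "\<bar>J z\<bar>"]
      by (simp add: right_diff_distrib[symmetric] abs_mult mult.commute)
  qed (intro integrable_continuous continuous_intros c u v continuous_on_subset[OF cont] subset_UNIV)+
  then have "\<bar>integral (cbox (-a) a) (\<lambda>z. J z * ?p u (x - z)) -
      integral (cbox (-a) a) (\<lambda>z. J z * ?p v (x - z))\<bar> \<le> mass * B"
    by (simp add: Henstock_Kurzweil_Integration.integral_diff integrable_continuous c u v mass_def mult.commute)
  then show ?thesis
    using le'[of x] by (simp add: rate_eq[OF u s] rate_eq[OF v s] distrib_right)
qed

text \<open>Integrating the weight \<open>exp (l * s)\<close> in time gains the factor
  \<open>1 / l\<close>, which beats the Lipschitz constant \<open>mass + 1\<close> once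
  \<open>l\<close> is large. No smallness of \<open>T\<close> is involved.\<close>

lemma picard_contraction:
  assumes u: "continuous_on (UNIV \<times> {0..T}) u" and v: "continuous_on (UNIV \<times> {0..T}) v"
    and le: "\<And>x s. s \<in> {0..T} \<Longrightarrow> \<bar>u (x, s) - v (x, s)\<bar> \<le> B * exp (l * s)"
    and l: "0 < l" and t: "t \<in> {0..T}"
  shows "\<bar>picard J f u (x, t) - picard J f v (x, t)\<bar> \<le> (mass + 1) / l * B * exp (l * t)"
proof -
  let ?c = "(mass + 1) * B"
  have B: "0 \<le> B"
    using le[OF t, of undefined] by (smt (verit) exp_gt_zero mult_neg_pos)
  note int = set_integrable_rate[OF u, of t x] set_integrable_rate[OF v, of t x]
  have E: "((\<lambda>s. ?c * exp (l * s)) has_integral ?c * exp (l * t) / l - ?c * exp (l * 0) / l) {0..t}"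
    using l t by (intro fundamental_theorem_of_calculus)
      (auto intro!: derivative_eq_intros simp: has_real_derivative_iff_has_vector_derivative[symmetric])
  have "\<bar>picard J f u (x, t) - picard J f v (x, t)\<bar> =
      \<bar>integral {0..t} (\<lambda>s. rate J u (x, s) - rate J v (x, s))\<bar>"
    using t int
    by (simp add: picard_def set_borel_integral_eq_integral Henstock_Kurzweil_Integration.integral_diff)
  also have "\<dots> \<le> integral {0..t} (\<lambda>s. ?c * exp (l * s))"
    unfolding real_norm_def[symmetric]
  proof (rule integral_norm_bound_integral)
    show "norm (rate J u (x, s) - rate J v (x, s)) \<le> ?c * exp (l * s)" if "s \<in> {0..t}" for s
      using rate_lipschitz[OF u v, of s "B * exp (l * s)"] le that t by (auto simp: mult.assoc)
    show "(\<lambda>s. rate J u (x, s) - rate J v (x, s)) integrable_on {0..t}"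
      using t int by (intro integrable_diff set_borel_integral_eq_integral) auto
  qed (use E in blast)
  also have "\<dots> = ?c * exp (l * t) / l - ?c / l"
    using integral_unique[OF E] by simp
  \<comment> \<open>The contribution \<open>?c / l\<close> of the lower endpoint is nonnegative and
    is dropped.\<close>
  also have "\<dots> \<le> (mass + 1) / l * B * exp (l * t)"
    using B l mass_nonneg by simp
  finally show ?thesis .
qed

section \<open>Uniqueness on bounded time intervals\<close>

lemma BC_solution_unique:
  assumes u: "BC_solution J f u" and v: "BC_solution J f v" and t: "0 \<le> t"
  shows "u (x, t) = v (x, t)"
proof -
  \<comment> \<open>Adding 1 keeps \<open>T\<close> positive at \<open>t = 0\<close>, as the
    \<open>BC\<close> condition requires; \<open>l\<close> is chosen to make the contraction factor
    \<open>1 / 2\<close>.\<close>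
  define T where "T = t + 1"
  define l where "l = 2 * (mass + 1)"
  have T: "T > 0" "t \<in> {0..T}" and l: "l > 0" "(mass + 1) / l = 1 / 2"
    using t mass_nonneg by (auto simp: T_def l_def)
  have fix_u: "u (x, s) = picard J f u (x, s)" and fix_v: "v (x, s) = picard J f v (x, s)"
    if "0 \<le> s" for x s
    using u v that by (auto simp: BC_solution_iff_picard)
  have cu: "continuous_on (UNIV \<times> {0..T}) u" and cv: "continuous_on (UNIV \<times> {0..T}) v"
    and bu: "bounded (u ` (UNIV \<times> {0..T}))" and bv: "bounded (v ` (UNIV \<times> {0..T}))"
    using u v T by (auto simp: BC_solution_iff_picard BC_def)
  obtain M where M: "\<And>x s. s \<in> {0..T} \<Longrightarrow> \<bar>u (x, s)\<bar> \<le> M"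
    using bu by (fastforce simp: bounded_iff)
  obtain N where N: "\<And>x s. s \<in> {0..T} \<Longrightarrow> \<bar>v (x, s)\<bar> \<le> N"
    using bv by (fastforce simp: bounded_iff)
  \<comment> \<open>Both functions are fixed by \<open>picard J f\<close>, so each application of
    the contraction halves the bound on their difference.\<close>
  have iter: "\<bar>u (x, s) - v (x, s)\<bar> \<le> (M + N) * (1 / 2) ^ n * exp (l * s)"
    if "s \<in> {0..T}" for n x s
    using that
  proof (induction n arbitrary: x s)
    case 0
    have "\<bar>u (x, s) - v (x, s)\<bar> \<le> M + N" "0 \<le> M + N"
      using M[OF 0, of x] N[OF 0, of x] by linarith+
    moreover have "1 \<le> exp (l * s)"
      using l 0 by simp
    ultimately show ?case
      using mult_left_mono[of 1 "exp (l * s)" "M + N"] by simp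
  next
    case (Suc n)
    then show ?case
      using picard_contraction[OF cu cv Suc.IH l(1) Suc.prems, of f x] fix_u[of s x] fix_v[of s x] l(2)
      by simp
  qed
  have "(\<lambda>n. (M + N) * (1 / 2) ^ n * exp (l * t)) \<longlonglongrightarrow> (M + N) * 0 * exp (l * t)"
    by (intro tendsto_intros LIMSEQ_realpow_zero) auto
  then have "\<bar>u (x, t) - v (x, t)\<bar> \<le> (M + N) * 0 * exp (l * t)"
    by (rule LIMSEQ_le_const) (use iter T in auto)
  then show ?thesis by simp
qed

section \<open>Existence by Banach's theorem in a weighted space\<close>

lemma continuous_on_picard:
  assumes "continuous_on UNIV f" "continuous_on (UNIV \<times> {0..}) u"
  shows "continuous_on (UNIV \<times> {0..}) (picard J f u)"
  using continuous_on_time_integral[OF continuous_on_rate[OF assms(2)]]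
  unfolding picard_def case_prod_unfold
  by (intro continuous_intros continuous_on_compose2[OF assms(1)]) auto

text \<open>Comparison with the zero function turns the contraction estimate into a growth bound for
  \<open>picard J f u\<close>.\<close>

lemma picard_zero: "picard J f (\<lambda>_. 0) (x, t) = f x"
  by (simp add: picard_def rate_def convolution_def)

lemma BC_solution_exists:
  assumes f: "f \<in> BC UNIV"
  shows "\<exists>u. BC_solution J f u"
proof -
  define l where "l = 2 * (mass + 1)"
  have l: "l > 0" "(mass + 1) / l = 1 / 2"
    using mass_nonneg by (auto simp: l_def)
  \<comment> \<open>The unknown is \<open>w = exp (- l * t) * u\<close>, so that the weighted norm
    of \<open>u\<close> becomes the plain supremum norm of \<open>w\<close>. Elements of the
    function space are total, hence \<open>down\<close> freezes negative times at 0, which preserves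
    continuity.\<close>
  define up :: "(('a \<times> real) \<Rightarrow>\<^sub>C real) \<Rightarrow> 'a \<times> real \<Rightarrow> real"
    where "up w p = exp (l * snd p) * w p" for w p
  define down where "down w p = exp (- (l * max (snd p) 0)) * picard J f (up w) (fst p, max (snd p) 0)" for w p
  have cup: "continuous_on S (up w)" for S w
    unfolding up_def by (intro continuous_intros continuous_on_apply_bcontfun)
  have cf: "continuous_on UNIV f"
    using f by (simp add: BC_def)
  obtain M where M: "\<And>x. \<bar>f x\<bar> \<le> M"
    using f by (auto simp: BC_def bounded_iff)
  \<comment> \<open>The second function stays arbitrary because it is taken to be 0 for boundedness
    of \<open>down w\<close> and \<open>up w'\<close> for the contraction.\<close>
  have contr: "\<bar>picard J f (up w) (x, t) - picard J f v (x, t)\<bar> \<le> B / 2 * exp (l * t)"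
    if "continuous_on UNIV v" "\<And>p. \<bar>up w p - v p\<bar> \<le> B * exp (l * snd p)" "0 \<le> t" for w v B x t
  proof -
    have "\<bar>picard J f (up w) (x, t) - picard J f v (x, t)\<bar> \<le> (mass + 1) / l * B * exp (l * t)"
    proof (rule picard_contraction)
      show "\<bar>up w (x, s) - v (x, s)\<bar> \<le> B * exp (l * s)" for x s
        using that(2)[of "(x, s)"] by simp
    qed (use cup l that continuous_on_subset[OF that(1)] in auto)
    then show ?thesis
      by (simp only: l(2))
  qed
  have unscale: "exp (- r) * y \<le> c" if "y \<le> c * exp r" for r y c :: real
    using that by (simp add: exp_minus divide_simps mult.commute)
  have bcont: "down w \<in> bcontfun" for w
  proof -
    have "continuous_on UNIV (down w)"
      unfolding down_def
      by (intro continuous_intros continuous_on_compose2[OF continuous_on_picard[OF cf cup]]) auto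
    moreover have "\<bar>down w p\<bar> \<le> M + norm w" for p
    proof -
      let ?t = "max (snd p) 0"
      have "\<bar>up w p - 0\<bar> \<le> norm w * exp (l * snd p)" for p
        using norm_bounded[of w p] by (simp add: up_def abs_mult mult.commute)
      from contr[OF continuous_on_const this, of ?t "fst p"]
      have "\<bar>picard J f (up w) (fst p, ?t)\<bar> \<le> \<bar>f (fst p)\<bar> + norm w / 2 * exp (l * ?t)"
        unfolding picard_zero by linarith
      also have "\<dots> \<le> M * exp (l * ?t) + norm w * exp (l * ?t)"
      proof (intro add_mono mult_right_mono)
        have "0 \<le> M" using M[of 0] by linarith
        then show "\<bar>f (fst p)\<bar> \<le> M * exp (l * ?t)"
          using M[of "fst p"] l mult_left_mono[of 1 "exp (l * ?t)" M] by simp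
      qed auto
      finally have "\<bar>picard J f (up w) (fst p, ?t)\<bar> \<le> (M + norm w) * exp (l * ?t)"
        by (simp only: distrib_right)
      then show ?thesis
        unfolding down_def abs_mult abs_exp_cancel by (rule unscale)
    qed
    ultimately show ?thesis
      by (auto simp: bcontfun_def bounded_iff)
  qed
  define Phi where "Phi w = Bcontfun (down w)" for w
  have Phi: "apply_bcontfun (Phi w) = down w" for w
    by (simp add: Phi_def Bcontfun_inverse bcont)
  have "dist (Phi w) (Phi w') \<le> 1 / 2 * dist w w'" for w w'
  proof (rule dist_bound)
    fix p :: "'a \<times> real"
    let ?t = "max (snd p) 0"
    have "\<bar>up w p - up w' p\<bar> \<le> dist w w' * exp (l * snd p)" for p
    proof -
      have "up w p - up w' p = (w p - w' p) * exp (l * snd p)"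
        by (simp add: up_def algebra_simps)
      then show ?thesis
        using dist_bounded[of w p w'] by (simp add: abs_mult dist_real_def)
    qed
    from contr[OF cup this, of ?t "fst p"]
    have "exp (- (l * ?t)) * \<bar>picard J f (up w) (fst p, ?t) - picard J f (up w') (fst p, ?t)\<bar>
        \<le> dist w w' / 2"
      by (intro unscale) simp
    then show "dist (Phi w p) (Phi w' p) \<le> 1 / 2 * dist w w'"
      by (simp add: Phi down_def dist_real_def right_diff_distrib[symmetric] abs_mult)
  qed
  then obtain w where w: "Phi w = w"
    using banach_fix_type[of "1/2" Phi] by auto
  have fp: "up w (x, t) = picard J f (up w) (x, t)" if "0 \<le> t" for x t
  proof -
    \<comment> \<open>For nonnegative \<open>t\<close> the truncation is inert, and cancelling the
      weights leaves the integral equation.\<close>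
    have "w (x, t) = down w (x, t)"
      using Phi[of w] w by simp
    then show ?thesis
      using that by (simp add: up_def[of w "(x, t)"] down_def exp_minus)
  qed
  \<comment> \<open>Undoing the weight costs at most the factor \<open>exp (l * T)\<close>, so
    boundedness holds on each finite time interval.\<close>
  have "up w \<in> BC (UNIV \<times> {0..T})" for T
  proof -
    have "\<bar>up w (x, t)\<bar> \<le> exp (l * T) * norm w" if "t \<in> {0..T}" for x t
      using norm_bounded[of w "(x, t)"] l that by (auto simp: up_def abs_mult intro!: mult_mono)
    then have "bounded (up w ` (UNIV \<times> {0..T}))"
      by (fastforce simp: bounded_iff)
    then show ?thesis
      using cup by (simp add: BC_def)
  qed
  with fp show ?thesis
    unfolding BC_solution_iff_picard by blast
qed

end

theorem theorem2p9:
  fixes J f :: "real ^ 'n \<Rightarrow> real"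
  assumes "continuous_on UNIV J"
    and "compactly_supported J"
    and "radially_symmetric J"
    and "(LINT x|lborel. J x) = 1"
    and "f \<in> BC UNIV"
  shows "\<exists>u. BC_solution J f u \<and>
           (\<forall>u'. BC_solution J f u' \<longrightarrow> (\<forall>x. \<forall>t\<ge>0. u' (x, t) = u (x, t)))"
proof -
  have "bounded (closure {x. J x \<noteq> 0})"
    using assms(2) by (simp add: compactly_supported_def compact_imp_bounded)
  then obtain a where a: "closure {x. J x \<noteq> 0} \<subseteq> cbox (-a) a"
    using bounded_subset_cbox_symmetric by blast
  interpret compact_kernel J a
  proof
    show "z \<in> cbox (-a) a" if "J z \<noteq> 0" for z
      using that by (intro subsetD[OF a] subsetD[OF closure_subset]) simp
  qed (fact assms(1))
  obtain u where "BC_solution J f u"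
    using BC_solution_exists[OF assms(5)] by auto
  then show ?thesis
    by (intro exI[of _ u] conjI allI impI BC_solution_unique)
qed

end
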